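(* Let $n\ge 2$ be an integer and let $\mathrm{M}$ be a matroid on $[n]=\{1,\ldots,n\}$. For every integer $m$ with $0<m<n$ and every $w\in\mathbb{R}^n_{\ge 0}$, $$\frac{f^m_{\mathrm{M}}(w)^2}{\binom{n}{m}^2}\ \ge\ \frac{f^{m+1}_{\mathrm{M}}(w)}{\binom{n}{m+1}}\,\frac{f^{m-1}_{\mathrm{M}}(w)}{\binom{n}{m-1}}.$$
   Context: For an integer $m\ge 0$, let $\mathscr{I}^m_{\mathrm{M}}$ be the collection of independent sets of $\mathrm{M}$ of size $m$. The $m$-th generating function of $\mathrm{M}$ is the homogeneous polynomial in $n$ variables $$f^m_{\mathrm{M}}(w)=\sum_{I\in\mathscr{I}^m_{\mathrm{M}}}\ \prod_{i\in I}w_i,\qquad w=(w_1,\ldots,w_n).$$ In particular $f^m_{\mathrm{M}}(1,\ldots,1)$ is the number of independent sets of $\mathrm{M}$ of size $m$. *)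

theory Defs
  imports Complex_Main
begin

locale matroid =
  fixes carrier :: "'a set"
    and indep :: "'a set \<Rightarrow> bool"
  assumes carrier_finite: "finite carrier"
    and indep_subset_carrier: "indep X \<Longrightarrow> X \<subseteq> carrier"
    and indep_empty: "indep {}"
    and indep_subset: "indep X \<Longrightarrow> Y \<subseteq> X \<Longrightarrow> indep Y"
    and augment:
      "indep X \<Longrightarrow> indep Y \<Longrightarrow> card Y < card X \<Longrightarrow> \<exists>x\<in>X - Y. indep (insert x Y)"

(* Meant for an indep satisfying the matroid axioms: independent sets are then finite and the
   index set of the sum is finite, so the conventions for card and sum on infinite sets do not
   intervene. *)
definition indep_sets_of_size :: "('a set \<Rightarrow> bool) \<Rightarrow> nat \<Rightarrow> 'a set set" where
  "indep_sets_of_size indep m = {I. indep I \<and> card I = m}"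

definition indep_gen_fun :: "('a set \<Rightarrow> bool) \<Rightarrow> nat \<Rightarrow> ('a \<Rightarrow> real) \<Rightarrow> real" where
  "indep_gen_fun indep m w = (\<Sum>I\<in>indep_sets_of_size indep m. \<Prod>i\<in>I. w i)"

end

theory Submission
  imports Defs "HOL-Library.Multiset"
begin

text \<open>
  Homogenise to \<open>g = \<Sum>\<^sub>I w\<^sub>0\<^bsup>n-|I|\<^esup> w\<^sup>I\<close>, a polynomial of degree \<open>n\<close>. The Hessian, at a
  positive point, of every iterated partial derivative of \<open>g\<close> satisfies a reverse Cauchy-Schwarz
  inequality against that point. For derivatives of degree two this follows from
  \<open>S\<^sup>2 \<le> r \<Sum>\<^sub>c S\<^sub>c\<^sup>2\<close>, where \<open>c\<close> ranges over the at most \<open>r\<close> parallel classes of a contraction.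
  In higher degree Euler's formula writes a Hessian \<open>W\<close> as the weighted sum of the Hessians of the
  partial derivatives, and their inequalities add up to \<open>P \<le> P\<^sup>2\<close> for the random walk \<open>P\<close>
  with weights \<open>W\<close>. Since the walk is connected through \<open>w\<^sub>0\<close>, the eigenvalue \<open>1\<close> is simple and
  all others are at most \<open>0\<close>. The corollary is this inequality for \<open>\<partial>\<^sub>0\<^bsup>n-m-1\<^esup> g\<close> tested
  on the direction \<open>w\<^sub>0\<close>, in the limit \<open>w\<^sub>0 \<rightarrow> 0\<close>.
\<close>

section \<open>Reverse Cauchy-Schwarz inequalities and random walks\<close>

text \<open>Reverse Cauchy-Schwarz for the form with matrix \<open>W\<close>, taken against the
  all-ones vector. A Hessian \<open>H\<close> at a positive point \<open>x\<close> enters as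
  \<open>x a * x b * H a b\<close>; this rescaling of the coordinates moves \<open>x\<close> to that
  vector.\<close>

definition hyperbolic_at_one :: "'v set \<Rightarrow> ('v \<Rightarrow> 'v \<Rightarrow> real) \<Rightarrow> bool" where
  "hyperbolic_at_one V W \<longleftrightarrow>
    (\<forall>y. (\<Sum>a\<in>V. \<Sum>b\<in>V. W a b * y a * y b) * (\<Sum>a\<in>V. \<Sum>b\<in>V. W a b)
      \<le> (\<Sum>a\<in>V. \<Sum>b\<in>V. W a b * y b)\<^sup>2)"

text \<open>One constant shift that makes the form nonpositive is enough: expanding it gives
  \<open>E \<le> 2 * t * L - t\<^sup>2 * T\<close>, and multiplication by \<open>T\<close> completes
  the square to \<open>L\<^sup>2 - (L - t * T)\<^sup>2\<close>.\<close>

lemma hyperbolic_at_oneI: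
  fixes W :: "'v \<Rightarrow> 'v \<Rightarrow> real"
  assumes sym: "\<And>a b. a \<in> V \<Longrightarrow> b \<in> V \<Longrightarrow> W a b = W b a"
    and nonneg: "(\<Sum>a\<in>V. \<Sum>b\<in>V. W a b) \<ge> 0"
    and shift: "\<And>y. \<exists>t. (\<Sum>a\<in>V. \<Sum>b\<in>V. W a b * (y a - t) * (y b - t)) \<le> 0"
  shows "hyperbolic_at_one V W"
  unfolding hyperbolic_at_one_def
proof
  fix y :: "'v \<Rightarrow> real"
  define E L T where "E = (\<Sum>a\<in>V. \<Sum>b\<in>V. W a b * y a * y b)"
    and "L = (\<Sum>a\<in>V. \<Sum>b\<in>V. W a b * y b)" and "T = (\<Sum>a\<in>V. \<Sum>b\<in>V. W a b)"
  obtain t where t: "(\<Sum>a\<in>V. \<Sum>b\<in>V. W a b * (y a - t) * (y b - t)) \<le> 0"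
    using shift by blast
  have "(\<Sum>a\<in>V. \<Sum>b\<in>V. W a b * y a) = (\<Sum>b\<in>V. \<Sum>a\<in>V. W a b * y a)"
    by (rule sum.swap)
  also have "\<dots> = L"
    unfolding L_def by (intro sum.cong refl) (simp add: sym)
  finally have L': "(\<Sum>a\<in>V. \<Sum>b\<in>V. W a b * y a) = L" .
  have "(\<Sum>a\<in>V. \<Sum>b\<in>V. W a b * (y a - t) * (y b - t))
      = (\<Sum>a\<in>V. \<Sum>b\<in>V. W a b * y a * y b - t * (W a b * y a) - t * (W a b * y b) + t\<^sup>2 * W a b)"
    by (intro sum.cong refl) (simp add: algebra_simps power2_eq_square)
  also have "\<dots> = E - t * L - t * L + t\<^sup>2 * T"
    by (simp add: sum.distrib sum_subtractf E_def T_def flip: sum_distrib_left L')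
       (simp add: L' flip: L_def)
  finally have "E \<le> 2 * t * L - t\<^sup>2 * T" using t by (simp add: algebra_simps)
  then have "E * T \<le> (2 * t * L - t\<^sup>2 * T) * T"
    using nonneg by (intro mult_right_mono) (auto simp: T_def)
  also have "\<dots> = L\<^sup>2 - (L - t * T)\<^sup>2"
    by (simp add: algebra_simps power2_eq_square)
  also have "\<dots> \<le> L\<^sup>2" by simp
  finally show "(\<Sum>a\<in>V. \<Sum>b\<in>V. W a b * y a * y b) * (\<Sum>a\<in>V. \<Sum>b\<in>V. W a b)
      \<le> (\<Sum>a\<in>V. \<Sum>b\<in>V. W a b * y b)\<^sup>2"
    unfolding E_def L_def T_def .
qed

section \<open>Random walks with symmetric nonnegative weights\<close>

locale reversible_weights =
  fixes V :: "'v set" and W :: "'v \<Rightarrow> 'v \<Rightarrow> real"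
  assumes fin: "finite V"
    and sym: "a \<in> V \<Longrightarrow> b \<in> V \<Longrightarrow> W a b = W b a"
    and nonneg: "a \<in> V \<Longrightarrow> b \<in> V \<Longrightarrow> W a b \<ge> 0"
begin

definition deg :: "'v \<Rightarrow> real" where "deg a = (\<Sum>b\<in>V. W a b)"
definition ip :: "('v \<Rightarrow> real) \<Rightarrow> ('v \<Rightarrow> real) \<Rightarrow> real" where
  "ip y z = (\<Sum>a\<in>V. deg a * y a * z a)"
definition form :: "('v \<Rightarrow> real) \<Rightarrow> ('v \<Rightarrow> real) \<Rightarrow> real" where
  "form y z = (\<Sum>a\<in>V. \<Sum>b\<in>V. W a b * y a * z b)"
text \<open>The transition operator P. Division by zero yields 0 at vertices of degree zero; the row
  of \<open>W\<close> vanishes there as well, so \<open>deg_walk\<close> holds at every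
  vertex.\<close>

definition walk :: "('v \<Rightarrow> real) \<Rightarrow> 'v \<Rightarrow> real" where
  "walk y a = (\<Sum>b\<in>V. W a b * y b) / deg a"

lemma deg_nonneg: "a \<in> V \<Longrightarrow> deg a \<ge> 0"
  by (simp add: deg_def nonneg sum_nonneg)

lemma W_eq_0: "a \<in> V \<Longrightarrow> b \<in> V \<Longrightarrow> deg a = 0 \<Longrightarrow> W a b = 0"
  using fin nonneg by (simp add: deg_def sum_nonneg_eq_0_iff)

lemma deg_walk: "a \<in> V \<Longrightarrow> deg a * walk y a = (\<Sum>b\<in>V. W a b * y b)"
  by (cases "deg a = 0") (simp_all add: walk_def W_eq_0)

lemma form_commute: "form y z = form z y"
proof -
  have "form y z = (\<Sum>b\<in>V. \<Sum>a\<in>V. W a b * y a * z b)"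
    unfolding form_def by (rule sum.swap)
  also have "\<dots> = form z y"
    unfolding form_def by (intro sum.cong refl) (simp add: sym mult.commute mult.left_commute)
  finally show ?thesis .
qed

lemma ip_commute: "ip y z = ip z y"
  by (simp add: ip_def mult.commute mult.left_commute)

lemma form_diff_right: "form y (\<lambda>a. r * z a - s * z' a) = r * form y z - s * form y z'"
proof -
  have "form y (\<lambda>a. r * z a - s * z' a)
      = (\<Sum>a\<in>V. \<Sum>b\<in>V. r * (W a b * y a * z b) - s * (W a b * y a * z' b))"
    unfolding form_def by (intro sum.cong refl) (simp add: algebra_simps)
  then show ?thesis by (simp add: form_def sum_subtractf sum_distrib_left)
qed

lemma ip_diff_right: "ip y (\<lambda>a. r * z a - s * z' a) = r * ip y z - s * ip y z'"
proof -
  have "ip y (\<lambda>a. r * z a - s * z' a)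
      = (\<Sum>a\<in>V. r * (deg a * y a * z a) - s * (deg a * y a * z' a))"
    unfolding ip_def by (intro sum.cong refl) (simp add: algebra_simps)
  then show ?thesis by (simp add: ip_def sum_subtractf sum_distrib_left)
qed

lemma form_diff_left: "form (\<lambda>a. r * z a - s * z' a) y = r * form z y - s * form z' y"
  using form_diff_right[of y r z s z'] by (simp add: form_commute)

lemma ip_diff_left: "ip (\<lambda>a. r * z a - s * z' a) y = r * ip z y - s * ip z' y"
  using ip_diff_right[of y r z s z'] by (simp add: ip_commute)

text \<open>The degree in \<open>ip\<close> cancels the denominator of the walk. As
  \<open>form\<close> is symmetric, P is self-adjoint for \<open>ip\<close>.\<close>

lemma ip_walk: "ip y (walk z) = form y z"
proof -
  have "ip y (walk z) = (\<Sum>a\<in>V. y a * (deg a * walk z a))"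
    by (simp add: ip_def mult.commute mult.left_commute)
  also have "\<dots> = form y z"
    by (simp add: form_def deg_walk sum_distrib_left mult.commute mult.left_commute)
  finally show ?thesis .
qed

lemma form_one: "form (\<lambda>_. 1) y = ip (\<lambda>_. 1) y"
  by (subst form_commute) (simp add: form_def ip_def deg_def sum_distrib_right)

lemma ip_one_walk: "ip (\<lambda>_. 1) (walk y) = ip (\<lambda>_. 1) y"
  by (simp add: ip_walk form_one)

lemma ip_self_nonneg: "ip y y \<ge> 0"
  unfolding ip_def by (intro sum_nonneg) (simp add: deg_nonneg mult.assoc)

lemma ip_self_double: "2 * ip y y = (\<Sum>a\<in>V. \<Sum>b\<in>V. W a b * ((y a)\<^sup>2 + (y b)\<^sup>2))"
proof -
  have 1: "ip y y = (\<Sum>a\<in>V. \<Sum>b\<in>V. W a b * (y a)\<^sup>2)"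
    by (simp add: ip_def deg_def sum_distrib_right power2_eq_square mult.assoc)
  also have "\<dots> = (\<Sum>b\<in>V. \<Sum>a\<in>V. W a b * (y a)\<^sup>2)" by (rule sum.swap)
  also have "\<dots> = (\<Sum>a\<in>V. \<Sum>b\<in>V. W a b * (y b)\<^sup>2)"
    by (intro sum.cong refl) (simp add: sym)
  finally show ?thesis using 1 by (simp add: distrib_left sum.distrib)
qed

text \<open>This is the Dirichlet form of the walk: \<open>ip y y\<close>, split evenly over both
  endpoints of each edge, completes the cross terms to squares.\<close>

lemma ip_minus_form: "2 * (ip y y - form y y) = (\<Sum>a\<in>V. \<Sum>b\<in>V. W a b * (y a - y b)\<^sup>2)"
proof -
  have "(\<Sum>a\<in>V. \<Sum>b\<in>V. W a b * (y a - y b)\<^sup>2)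
      = (\<Sum>a\<in>V. \<Sum>b\<in>V. W a b * ((y a)\<^sup>2 + (y b)\<^sup>2) - 2 * (W a b * y a * y b))"
    by (intro sum.cong refl) (simp add: algebra_simps power2_eq_square)
  then show ?thesis
    by (simp add: sum_subtractf ip_self_double form_def right_diff_distrib flip: sum_distrib_left)
qed

text \<open>Sums of \<open>W a b * (y a + y b)\<^sup>2\<close> are nonnegative, so no eigenvalue of
  the walk lies below -1.\<close>

lemma form_ge: "- ip y y \<le> form y y"
proof -
  have "(\<Sum>a\<in>V. \<Sum>b\<in>V. W a b * (y a + y b)\<^sup>2)
      = (\<Sum>a\<in>V. \<Sum>b\<in>V. W a b * ((y a)\<^sup>2 + (y b)\<^sup>2) + 2 * (W a b * y a * y b))"
    by (intro sum.cong refl) (simp add: algebra_simps power2_eq_square)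
  then have "2 * (ip y y + form y y) = (\<Sum>a\<in>V. \<Sum>b\<in>V. W a b * (y a + y b)\<^sup>2)"
    by (simp add: sum.distrib ip_self_double form_def distrib_left flip: sum_distrib_left)
  moreover have "(\<Sum>a\<in>V. \<Sum>b\<in>V. W a b * (y a + y b)\<^sup>2) \<ge> 0"
    by (intro sum_nonneg) (simp add: nonneg)
  ultimately show ?thesis by simp
qed

text \<open>A Poincare inequality: every vertex of positive degree is a neighbour of
  \<open>o'\<close>, so the edges at \<open>o'\<close> alone control the variance.\<close>

lemma spectral_gap:
  assumes o: "o' \<in> V" and conn: "\<And>a. a \<in> V \<Longrightarrow> deg a > 0 \<Longrightarrow> W o' a > 0"
  obtains \<theta> where "0 \<le> \<theta>" "\<theta> < 1"
    "\<And>y. ip (\<lambda>_. 1) y = 0 \<Longrightarrow> form y y \<le> \<theta> * ip y y"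
proof -
  \<comment> \<open>The least probability of stepping from a vertex of positive degree to
    \<open>o'\<close>. The inserted 1 keeps the set nonempty and gives \<open>c \<le> 1\<close>,
    hence \<open>1 - c / 2 \<ge> 0\<close>.\<close>
  define c where "c = Min (insert 1 ((\<lambda>a. W o' a / deg a) ` {a\<in>V. deg a > 0}))"
  have cpos: "c > 0" unfolding c_def using fin conn by (subst Min_gr_iff) auto
  have c1: "c \<le> 1" unfolding c_def using fin by (intro Min_le) auto
  have cle: "c * deg a \<le> W o' a" if a: "a \<in> V" for a
  proof (cases "deg a > 0")
    case True
    have "c \<le> W o' a / deg a" unfolding c_def using fin a True by (intro Min_le) auto
    then show ?thesis using True by (simp add: field_simps)
  next
    case False
    then show ?thesis using deg_nonneg[OF a] nonneg[OF o a] by simp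
  qed
  have "form y y \<le> (1 - c / 2) * ip y y" if y: "ip (\<lambda>_. 1) y = 0" for y
  proof -
    \<comment> \<open>Second moment about \<open>y o'\<close>; the cross term vanishes because
      \<open>y\<close> has mean zero.\<close>
    have *: "ip y y + ip (\<lambda>_. 1) (\<lambda>_. 1) * (y o')\<^sup>2 = (\<Sum>a\<in>V. deg a * (y a - y o')\<^sup>2)"
    proof -
      have "(\<Sum>a\<in>V. deg a * (y a - y o')\<^sup>2)
        = (\<Sum>a\<in>V. deg a * y a * y a - 2 * y o' * (deg a * 1 * y a) + (deg a * 1 * 1) * (y o')\<^sup>2)"
        by (intro sum.cong refl) (simp add: algebra_simps power2_eq_square)
      also have "\<dots> = ip y y - 2 * y o' * ip (\<lambda>_. 1) y + ip (\<lambda>_. 1) (\<lambda>_. 1) * (y o')\<^sup>2"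
        by (simp only: ip_def sum.distrib sum_subtractf sum_distrib_left sum_distrib_right)
      finally show ?thesis using y by simp
    qed
    have "c * ip y y \<le> c * (\<Sum>a\<in>V. deg a * (y a - y o')\<^sup>2)"
      unfolding *[symmetric] using cpos ip_self_nonneg[of "\<lambda>_. 1"] by simp
    also have "\<dots> = (\<Sum>a\<in>V. (c * deg a) * (y o' - y a)\<^sup>2)"
      by (simp add: sum_distrib_left mult.assoc power2_commute)
    also have "\<dots> \<le> (\<Sum>a\<in>V. W o' a * (y o' - y a)\<^sup>2)"
      by (intro sum_mono mult_right_mono cle) auto
    \<comment> \<open>The left side is the single row \<open>o'\<close> of the Dirichlet
      sum.\<close>
    also have "\<dots> \<le> (\<Sum>b\<in>V. \<Sum>a\<in>V. W b a * (y b - y a)\<^sup>2)"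
      using fin o by (intro member_le_sum sum_nonneg) (auto simp: nonneg)
    also have "\<dots> = 2 * (ip y y - form y y)" by (rule ip_minus_form[symmetric])
    finally show ?thesis by (simp add: algebra_simps)
  qed
  with cpos c1 show thesis by (intro that[of "1 - c / 2"]) auto
qed

text \<open>If \<open>0 \<le> \<theta> - P\<close> on the complement of the constants, then \<open>-1 \<le> P\<close> gives
  \<open>(\<theta> - P)\<^sup>2 \<le> (\<theta> + 1) (\<theta> - P)\<close>; together with \<open>P \<le> P\<^sup>2\<close> this improves \<open>\<theta>\<close>.\<close>

lemma gap_improve:
  assumes \<theta>: "0 \<le> \<theta>" "\<theta> < 1"
    and gap: "\<And>y. ip (\<lambda>_. 1) y = 0 \<Longrightarrow> form y y \<le> \<theta> * ip y y"
    and sq: "\<And>y. form y y \<le> ip (walk y) (walk y)"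
    and y: "ip (\<lambda>_. 1) y = 0"
  shows "form y y \<le> \<theta> / (2 - \<theta>) * ip y y"
proof -
  define z where "z = (\<lambda>a. \<theta> * y a - 1 * walk y a)"
  \<comment> \<open>This value maximises \<open>2 * t - t\<^sup>2 * (\<theta> + 1)\<close>. Applying
    the gap to \<open>y - t * z\<close> with \<open>z\<close> = (\<theta> - P) y replaces an appeal
    to spectral calculus.\<close>
  define t where "t = 1 / (\<theta> + 1)"
  define v where "v = (\<lambda>a. 1 * y a - t * z a)"
  have t: "t > 0" "t * (\<theta> + 1) = 1" using \<theta> by (auto simp: t_def)
  have z0: "ip (\<lambda>_. 1) z = 0" unfolding z_def ip_diff_right by (simp add: y ip_one_walk)
  have v0: "ip (\<lambda>_. 1) v = 0" unfolding v_def ip_diff_right by (simp add: y z0)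
  have zz: "ip z z = \<theta> * ip y z - form y z"
  proof -
    have "ip z z = ip z (\<lambda>a. \<theta> * y a - 1 * walk y a)" by (simp add: z_def)
    also have "\<dots> = \<theta> * ip y z - form y z"
      unfolding ip_diff_right by (simp add: ip_walk ip_commute[of z y] form_commute[of z y])
    finally show ?thesis .
  qed
  have "form v v = form y y - 2 * t * form y z + t\<^sup>2 * form z z"
    unfolding v_def form_diff_right form_diff_left
    by (simp add: form_commute[of z y] algebra_simps power2_eq_square)
  moreover have "ip v v = ip y y - 2 * t * ip y z + t\<^sup>2 * ip z z"
    unfolding v_def ip_diff_right ip_diff_left
    by (simp add: ip_commute[of z y] algebra_simps power2_eq_square)
  ultimately have "form y y - 2 * t * form y z + t\<^sup>2 * form z z
      \<le> \<theta> * (ip y y - 2 * t * ip y z + t\<^sup>2 * ip z z)"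
    using gap[OF v0] by simp
  then have "form y y + 2 * t * ip z z + t\<^sup>2 * form z z \<le> \<theta> * ip y y + \<theta> * t\<^sup>2 * ip z z"
    unfolding zz by (simp add: algebra_simps)
  moreover have "t\<^sup>2 * form z z \<ge> - (t\<^sup>2 * ip z z)"
    using form_ge[of z] t(1) by (metis mult_left_mono mult_minus_right zero_le_power2)
  ultimately have "form y y + 2 * t * ip z z \<le> \<theta> * ip y y + t * (t * (\<theta> + 1)) * ip z z"
    by (simp add: algebra_simps power2_eq_square)
  then have "t * ip z z \<le> \<theta> * ip y y - form y y" by (simp add: t(2))
  then have "(\<theta> + 1) * (t * ip z z) \<le> (\<theta> + 1) * (\<theta> * ip y y - form y y)"
    using \<theta> by (intro mult_left_mono) auto
  then have "ip z z \<le> (\<theta> + 1) * (\<theta> * ip y y - form y y)"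
    using t(2) by (metis mult.assoc mult.commute mult.left_neutral)
  \<comment> \<open>With \<open>sq\<close> the last summand is at least \<open>form y y\<close>,
    which turns the upper bound on \<open>ip z z\<close> into a bound on
    \<open>form y y\<close>.\<close>
  moreover have "ip z z = \<theta>\<^sup>2 * ip y y - 2 * \<theta> * form y y + ip (walk y) (walk y)"
    unfolding z_def ip_diff_right ip_diff_left
    by (simp add: ip_walk ip_commute[of "walk y" y] algebra_simps power2_eq_square)
  ultimately have "(2 - \<theta>) * form y y \<le> \<theta> * ip y y"
    using sq[of y] by (simp add: algebra_simps power2_eq_square)
  then show ?thesis using \<theta> by (simp add: field_simps)
qed

text \<open>The infimum \<theta> of all admissible constants is itself admissible, and so is
  \<open>\<theta> / (2 - \<theta>)\<close> by \<open>gap_improve\<close>. Minimality then gives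
  \<open>\<theta> * (1 - \<theta>) \<le> 0\<close>, and \<theta> < 1 leaves only \<theta> =
  0.\<close>

lemma form_nonpos:
  assumes o: "o' \<in> V" and conn: "\<And>a. a \<in> V \<Longrightarrow> deg a > 0 \<Longrightarrow> W o' a > 0"
    and sq: "\<And>y. form y y \<le> ip (walk y) (walk y)"
    and y: "ip (\<lambda>_. 1) y = 0"
  shows "form y y \<le> 0"
proof -
  define S where
    "S = {\<theta>. 0 \<le> \<theta> \<and> \<theta> < 1 \<and> (\<forall>y. ip (\<lambda>_. 1) y = 0 \<longrightarrow> form y y \<le> \<theta> * ip y y)}"
  obtain \<theta>0 where \<theta>0: "\<theta>0 \<in> S" using spectral_gap[OF o conn] unfolding S_def by blast
  have bdd: "bdd_below S" by (intro bdd_belowI[of _ 0]) (auto simp: S_def)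
  define \<theta> where "\<theta> = Inf S"
  have \<theta>: "0 \<le> \<theta>" "\<theta> < 1"
    using \<theta>0 cInf_lower[OF \<theta>0 bdd] unfolding \<theta>_def
    by (auto intro!: cInf_greatest simp: S_def)
  have gap: "form y y \<le> \<theta> * ip y y" if "ip (\<lambda>_. 1) y = 0" for y
  proof (cases "ip y y = 0")
    case True
    then show ?thesis using \<theta>0 that unfolding S_def by force
  next
    case False
    then have pos: "ip y y > 0" using ip_self_nonneg[of y] by simp
    have "form y y / ip y y \<le> \<theta>" unfolding \<theta>_def
      using \<theta>0 pos that by (intro cInf_greatest) (auto simp: S_def field_simps)
    then show ?thesis using pos by (simp add: field_simps)
  qed
  have "\<theta> / (2 - \<theta>) \<le> \<theta>" using \<theta> by (simp add: field_simps mult_left_le)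
  then have "\<theta> / (2 - \<theta>) \<in> S"
    using gap_improve[OF \<theta> gap sq] \<theta> by (auto simp: S_def)
  then have "\<theta> \<le> \<theta> / (2 - \<theta>)" unfolding \<theta>_def using bdd by (rule cInf_lower)
  then have "\<theta> * (1 - \<theta>) \<le> 0" using \<theta> by (simp add: field_simps)
  then have "\<theta> = 0" using \<theta> by (simp add: mult_le_0_iff)
  then show ?thesis using gap[OF y] by simp
qed

end

text \<open>The inequality for \<open>C i\<close>, divided by \<open>deg i\<close>, bounds its
  energy by the \<open>i\<close>-th term of \<open>ip (walk y) (walk y)\<close>. Summation over
  \<open>i\<close> gives P \<le> P^2, and \<open>form_nonpos\<close> makes \<open>W\<close>
  nonpositive on vectors of mean zero.\<close>

lemma trickle_down:
  fixes W :: "'v \<Rightarrow> 'v \<Rightarrow> real" and C :: "'v \<Rightarrow> 'v \<Rightarrow> 'v \<Rightarrow> real"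
  assumes fin: "finite V"
    and sym: "\<And>a b. a \<in> V \<Longrightarrow> b \<in> V \<Longrightarrow> W a b = W b a"
    and C_nonneg: "\<And>i a b. i \<in> V \<Longrightarrow> a \<in> V \<Longrightarrow> b \<in> V \<Longrightarrow> C i a b \<ge> 0"
    and sum_C: "\<And>a b. a \<in> V \<Longrightarrow> b \<in> V \<Longrightarrow> W a b = (\<Sum>i\<in>V. C i a b)"
    and row_C: "\<And>i b. i \<in> V \<Longrightarrow> b \<in> V \<Longrightarrow> (\<Sum>a\<in>V. C i a b) = W i b"
    and hyp: "\<And>i. i \<in> V \<Longrightarrow> hyperbolic_at_one V (C i)"
    and o: "o' \<in> V"
    and conn: "\<And>a. a \<in> V \<Longrightarrow> (\<Sum>b\<in>V. W a b) > 0 \<Longrightarrow> W o' a > 0"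
  shows "hyperbolic_at_one V W"
proof -
  have Wnn: "W a b \<ge> 0" if "a \<in> V" "b \<in> V" for a b
    using that by (simp add: sum_C C_nonneg sum_nonneg)
  interpret reversible_weights V W
    using fin sym Wnn by unfold_locales auto
  have tot: "(\<Sum>a\<in>V. \<Sum>b\<in>V. C i a b * y b) = deg i * walk y i" if i: "i \<in> V" for i y
  proof -
    have "(\<Sum>a\<in>V. \<Sum>b\<in>V. C i a b * y b) = (\<Sum>b\<in>V. \<Sum>a\<in>V. C i a b * y b)" by (rule sum.swap)
    also have "\<dots> = (\<Sum>b\<in>V. W i b * y b)"
      using i by (simp add: row_C flip: sum_distrib_right)
    finally show ?thesis using i by (simp add: deg_walk)
  qed
  have tot1: "(\<Sum>a\<in>V. \<Sum>b\<in>V. C i a b) = deg i" if i: "i \<in> V" for i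
  proof -
    have "(\<Sum>a\<in>V. \<Sum>b\<in>V. C i a b) = (\<Sum>b\<in>V. \<Sum>a\<in>V. C i a b)" by (rule sum.swap)
    then show ?thesis using i by (simp add: row_C deg_def)
  qed
  have sq: "form y y \<le> ip (walk y) (walk y)" for y
  proof -
    have "form y y = (\<Sum>a\<in>V. \<Sum>b\<in>V. \<Sum>i\<in>V. C i a b * y a * y b)"
      unfolding form_def by (intro sum.cong refl) (simp add: sum_C sum_distrib_right)
    also have "\<dots> = (\<Sum>i\<in>V. \<Sum>a\<in>V. \<Sum>b\<in>V. C i a b * y a * y b)"
      by (subst sum.swap[of _ V V], subst (2) sum.swap) (intro sum.cong refl sum.swap)
    also have "\<dots> \<le> (\<Sum>i\<in>V. deg i * walk y i * walk y i)"
    proof (intro sum_mono)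
      fix i assume i: "i \<in> V"
      define e where "e = (\<Sum>a\<in>V. \<Sum>b\<in>V. C i a b * y a * y b)"
      have le: "e * deg i \<le> (deg i * walk y i)\<^sup>2"
        using hyp[OF i, unfolded hyperbolic_at_one_def, rule_format, of y]
        by (simp add: tot[OF i] tot1[OF i] e_def)
      show "e \<le> deg i * walk y i * walk y i"
      proof (cases "deg i = 0")
        \<comment> \<open>No division by \<open>deg i\<close> is possible here; but nonnegative
          entries with total \<open>deg i\<close> = 0 all vanish.\<close>
        case True
        have "\<forall>a\<in>V. (\<Sum>b\<in>V. C i a b) = 0"
          using tot1[OF i] True fin C_nonneg i by (simp add: sum_nonneg_eq_0_iff sum_nonneg)
        then have "\<forall>a\<in>V. \<forall>b\<in>V. C i a b = 0"
          using fin C_nonneg i by (simp add: sum_nonneg_eq_0_iff)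
        then show ?thesis using True by (simp add: e_def)
      next
        case False
        then have "deg i > 0" using deg_nonneg[OF i] by simp
        then show ?thesis using le by (simp add: power2_eq_square mult.assoc mult.left_commute)
      qed
    qed
    finally show ?thesis by (simp add: ip_def)
  qed
  have neg: "form y y \<le> 0" if "ip (\<lambda>_. 1) y = 0" for y
    using o conn sq that by (intro form_nonpos) (auto simp: deg_def)
  show ?thesis
  proof (rule hyperbolic_at_oneI)
    show "(\<Sum>a\<in>V. \<Sum>b\<in>V. W a b) \<ge> 0" by (intro sum_nonneg Wnn)
    fix y :: "'v \<Rightarrow> real"
    \<comment> \<open>The mean of \<open>y\<close> with respect to the degrees, so that
      \<open>y - t\<close> is orthogonal to the constants.\<close>
    define t where "t = ip (\<lambda>_. 1) y / ip (\<lambda>_. 1) (\<lambda>_. 1)"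
    have "form (\<lambda>a. 1 * y a - t * 1) (\<lambda>a. 1 * y a - t * 1) \<le> 0"
    proof (cases "ip (\<lambda>_. 1) (\<lambda>_. 1) = 0")
      case True
      then have "\<forall>a\<in>V. deg a = 0"
        using fin deg_nonneg by (simp add: ip_def sum_nonneg_eq_0_iff)
      then show ?thesis by (simp add: form_def W_eq_0)
    next
      case False
      have "ip (\<lambda>_. 1) (\<lambda>a. 1 * y a - t * 1) = ip (\<lambda>_. 1) y - t * ip (\<lambda>_. 1) (\<lambda>_. 1)"
        by (subst ip_diff_right) simp
      then have "ip (\<lambda>_. 1) (\<lambda>a. 1 * y a - t * 1) = 0" using False by (simp add: t_def)
      then show ?thesis by (rule neg)
    qed
    then show "\<exists>t. (\<Sum>a\<in>V. \<Sum>b\<in>V. W a b * (y a - t) * (y b - t)) \<le> 0"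
      by (intro exI[of _ t]) (simp add: form_def)
  qed (rule sym)
qed

section \<open>Log-concavity from derivatives of degree two\<close>

text \<open>If \<open>\<phi> u\<close> is the derivative \<open>\<partial>\<^sup>u g\<close> of top order, then \<open>wsum V x \<phi> d u\<close> is \<open>d!\<close> times the
  value at \<open>x\<close> of the degree \<open>d\<close> form \<open>\<partial>\<^sup>u g\<close>; the recursion is Euler's formula.\<close>

primrec wsum :: "'v set \<Rightarrow> ('v \<Rightarrow> real) \<Rightarrow> ('v multiset \<Rightarrow> real) \<Rightarrow> nat \<Rightarrow> 'v multiset \<Rightarrow> real" where
  "wsum V x \<phi> 0 u = \<phi> u"
| "wsum V x \<phi> (Suc d) u = (\<Sum>a\<in>V. x a * wsum V x \<phi> d (add_mset a u))"

lemma wsum_nonneg: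
  assumes "\<And>a. a \<in> V \<Longrightarrow> x a \<ge> 0" "\<And>u. \<phi> u \<ge> 0"
  shows "wsum V x \<phi> d u \<ge> 0"
  using assms by (induction d arbitrary: u) (auto intro!: sum_nonneg)

text \<open>Provides the connectivity through \<open>o'\<close> asked for by
  \<open>trickle_down\<close>. A positive sum has a positive summand, in which the induction
  hypothesis exchanges \<open>a\<close> for \<open>o'\<close>.\<close>

lemma wsum_pos_exchange:
  assumes fin: "finite V" and x: "\<And>a. a \<in> V \<Longrightarrow> x a > 0" and \<phi>: "\<And>u. \<phi> u \<ge> 0"
    and ex: "\<And>a u. a \<in> V \<Longrightarrow> \<phi> (add_mset a u) > 0 \<Longrightarrow> \<phi> (add_mset o' u) > 0"
    and a: "a \<in> V" and pos: "wsum V x \<phi> d (add_mset a u) > 0"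
  shows "wsum V x \<phi> d (add_mset o' u) > 0"
  using pos
proof (induction d arbitrary: u)
  case 0
  then show ?case using ex[OF a] by simp
next
  case (Suc d)
  have nn: "wsum V x \<phi> d v \<ge> 0" for v
    using x \<phi> by (intro wsum_nonneg) (auto simp: less_imp_le)
  have "\<exists>c\<in>V. x c * wsum V x \<phi> d (add_mset c (add_mset a u)) > 0"
  proof (rule ccontr)
    assume "\<not> ?thesis"
    then have "wsum V x \<phi> (Suc d) (add_mset a u) \<le> 0" by (auto intro!: sum_nonpos simp: not_less)
    with Suc.prems show False by simp
  qed
  then obtain c where c: "c \<in> V" "x c * wsum V x \<phi> d (add_mset c (add_mset a u)) > 0" by blast
  have "wsum V x \<phi> d (add_mset a (add_mset c u)) > 0"
    using c x[OF c(1)] by (simp add: zero_less_mult_iff add_mset_commute)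
  from Suc.IH[OF this] have "wsum V x \<phi> d (add_mset c (add_mset o' u)) > 0"
    by (simp add: add_mset_commute)
  then have "x c * wsum V x \<phi> d (add_mset c (add_mset o' u)) > 0" using x[OF c(1)] by simp
  then show ?case using fin c(1) x nn
    by (auto intro!: sum_pos2[of V c] mult_nonneg_nonneg simp: less_imp_le)
qed

text \<open>Induction on the degree. The matrices \<open>C i\<close> are \<open>x i\<close> times
  the rescaled Hessians of the \<open>i\<close>-th partial derivatives; both their sum and their row
  sums are given by Euler's formula, since derivatives commute.\<close>

theorem wsum_hyperbolic:
  assumes fin: "finite V" and o: "o' \<in> V"
    and x: "\<And>a. a \<in> V \<Longrightarrow> x a > 0" and \<phi>: "\<And>u. \<phi> u \<ge> 0"
    and ex: "\<And>a u. a \<in> V \<Longrightarrow> \<phi> (add_mset a u) > 0 \<Longrightarrow> \<phi> (add_mset o' u) > 0"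
    and base: "\<And>u. size u = N \<Longrightarrow> set_mset u \<subseteq> V \<Longrightarrow>
      hyperbolic_at_one V (\<lambda>a b. x a * x b * \<phi> (add_mset a (add_mset b u)))"
    and u: "set_mset u \<subseteq> V" "size u + d = N"
  shows "hyperbolic_at_one V (\<lambda>a b. x a * x b * wsum V x \<phi> d (add_mset a (add_mset b u)))"
  using u
proof (induction d arbitrary: u)
  case 0
  then show ?case using base by simp
next
  case (Suc d)
  have nn: "wsum V x \<phi> k v \<ge> 0" for k v
    using x \<phi> by (intro wsum_nonneg) (auto simp: less_imp_le)
  show ?case
  proof (rule trickle_down[OF fin, where
        C = "\<lambda>i a b. x i * (x a * x b * wsum V x \<phi> d (add_mset a (add_mset b (add_mset i u))))"])
    fix a b :: 'a
    show "x a * x b * wsum V x \<phi> (Suc d) (add_mset a (add_mset b u))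
        = x b * x a * wsum V x \<phi> (Suc d) (add_mset b (add_mset a u))"
      by (simp only: add_mset_commute mult.commute)
    show "x a * x b * wsum V x \<phi> (Suc d) (add_mset a (add_mset b u))
        = (\<Sum>i\<in>V. x i * (x a * x b * wsum V x \<phi> d (add_mset a (add_mset b (add_mset i u)))))"
      by (simp add: sum_distrib_left add_mset_commute mult.left_commute)
    fix i assume i: "i \<in> V"
    then show "x i * (x a * x b * wsum V x \<phi> d (add_mset a (add_mset b (add_mset i u)))) \<ge> 0"
      if "a \<in> V" "b \<in> V"
      using that nn x by (intro mult_nonneg_nonneg) (auto simp: less_imp_le)
    show "(\<Sum>a\<in>V. x i * (x a * x b * wsum V x \<phi> d (add_mset a (add_mset b (add_mset i u)))))
        = x i * x b * wsum V x \<phi> (Suc d) (add_mset i (add_mset b u))"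
      by (simp add: sum_distrib_left add_mset_commute mult.left_commute mult.assoc)
  next
    fix i assume i: "i \<in> V"
    define W where "W = (\<lambda>a b. x a * x b * wsum V x \<phi> d (add_mset a (add_mset b (add_mset i u))))"
    have W: "hyperbolic_at_one V W"
      unfolding W_def using i Suc.prems by (intro Suc.IH) auto
    show "hyperbolic_at_one V (\<lambda>a b. x i * (x a * x b * wsum V x \<phi> d (add_mset a (add_mset b (add_mset i u)))))"
      unfolding hyperbolic_at_one_def
    proof
      fix y :: "'a \<Rightarrow> real"
      \<comment> \<open>Both sides of the inequality are quadratic in the matrix, so a factor
        \<open>x i\<close> is harmless.\<close>
      have "(x i)\<^sup>2 * ((\<Sum>a\<in>V. \<Sum>b\<in>V. W a b * y a * y b) * (\<Sum>a\<in>V. \<Sum>b\<in>V. W a b))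
          \<le> (x i)\<^sup>2 * (\<Sum>a\<in>V. \<Sum>b\<in>V. W a b * y b)\<^sup>2"
        using W unfolding hyperbolic_at_one_def by (intro mult_left_mono) auto
      then show "(\<Sum>a\<in>V. \<Sum>b\<in>V. x i * (x a * x b * wsum V x \<phi> d (add_mset a (add_mset b (add_mset i u)))) * y a * y b)
        * (\<Sum>a\<in>V. \<Sum>b\<in>V. x i * (x a * x b * wsum V x \<phi> d (add_mset a (add_mset b (add_mset i u)))))
        \<le> (\<Sum>a\<in>V. \<Sum>b\<in>V. x i * (x a * x b * wsum V x \<phi> d (add_mset a (add_mset b (add_mset i u)))) * y b)\<^sup>2"
        unfolding W_def[symmetric, THEN fun_cong, THEN fun_cong]
        by (simp add: mult.assoc power2_eq_square flip: sum_distrib_left)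
           (simp add: algebra_simps)
    qed
  next
    show "o' \<in> V" by (rule o)
    fix a assume a: "a \<in> V"
      and "(\<Sum>b\<in>V. x a * x b * wsum V x \<phi> (Suc d) (add_mset a (add_mset b u))) > 0"
    then obtain b where b: "b \<in> V" "x a * x b * wsum V x \<phi> (Suc d) (add_mset a (add_mset b u)) > 0"
      by (meson not_less sum_nonpos)
    then have "x a * x b > 0" using a x by simp
    then have "wsum V x \<phi> (Suc d) (add_mset b (add_mset a u)) > 0"
      using b(2) by (simp only: zero_less_mult_pos add_mset_commute[of b a])
    from wsum_pos_exchange[OF fin x \<phi> ex b(1) this]
    have "wsum V x \<phi> (Suc d) (add_mset o' (add_mset a u)) > 0" by simp
    then show "x o' * x a * wsum V x \<phi> (Suc d) (add_mset o' (add_mset a u)) > 0"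
      using x[OF o] x[OF a] by (metis mult_pos_pos)
  qed
qed

text \<open>Testing on the indicator of \<open>o'\<close> extracts the diagonal entry at
  \<open>o'\<close> and the row of \<open>o'\<close>. Euler's formula evaluates the row sum and the
  total, and \<open>(x o')\<^sup>2\<close> cancels.\<close>

corollary wsum_log_concave:
  assumes fin: "finite V" and o: "o' \<in> V"
    and x: "\<And>a. a \<in> V \<Longrightarrow> x a > 0" and \<phi>: "\<And>u. \<phi> u \<ge> 0"
    and ex: "\<And>a u. a \<in> V \<Longrightarrow> \<phi> (add_mset a u) > 0 \<Longrightarrow> \<phi> (add_mset o' u) > 0"
    and base: "\<And>u. size u = N \<Longrightarrow> set_mset u \<subseteq> V \<Longrightarrow>
      hyperbolic_at_one V (\<lambda>a b. x a * x b * \<phi> (add_mset a (add_mset b u)))"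
    and u: "set_mset u \<subseteq> V" "size u + d = N"
  shows "wsum V x \<phi> d (add_mset o' (add_mset o' u)) * wsum V x \<phi> (Suc (Suc d)) u
    \<le> (wsum V x \<phi> (Suc d) (add_mset o' u))\<^sup>2"
proof -
  define A where "A = wsum V x \<phi>"
  define y :: "'a \<Rightarrow> real" where "y = (\<lambda>a. if a = o' then 1 else 0)"
  have "(\<Sum>a\<in>V. \<Sum>b\<in>V. x a * x b * A d (add_mset a (add_mset b u)) * y a * y b)
      = (\<Sum>a\<in>V. \<Sum>b\<in>V. if b = o' then
          if a = o' then (x o')\<^sup>2 * A d (add_mset o' (add_mset o' u)) else 0 else 0)"
    by (intro sum.cong refl) (simp add: y_def power2_eq_square)
  also have "\<dots> = (x o')\<^sup>2 * A d (add_mset o' (add_mset o' u))"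
    using fin o by simp
  finally have E: "(\<Sum>a\<in>V. \<Sum>b\<in>V. x a * x b * A d (add_mset a (add_mset b u)) * y a * y b)
      = (x o')\<^sup>2 * A d (add_mset o' (add_mset o' u))" .
  have L: "(\<Sum>a\<in>V. \<Sum>b\<in>V. x a * x b * A d (add_mset a (add_mset b u)) * y b)
      = x o' * A (Suc d) (add_mset o' u)"
  proof -
    have "(\<Sum>a\<in>V. \<Sum>b\<in>V. x a * x b * A d (add_mset a (add_mset b u)) * y b)
        = (\<Sum>a\<in>V. \<Sum>b\<in>V. if b = o' then x o' * (x a * A d (add_mset a (add_mset o' u))) else 0)"
      by (intro sum.cong refl) (simp add: y_def)
    then show ?thesis using fin o by (simp add: A_def sum_distrib_left)
  qed
  have T: "(\<Sum>a\<in>V. \<Sum>b\<in>V. x a * x b * A d (add_mset a (add_mset b u))) = A (Suc (Suc d)) u"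
    by (simp add: A_def sum_distrib_left mult.assoc add_mset_commute)
  have hyp: "hyperbolic_at_one V (\<lambda>a b. x a * x b * A d (add_mset a (add_mset b u)))"
    unfolding A_def
  proof (rule wsum_hyperbolic[where N = N and o' = o'])
    show "hyperbolic_at_one V (\<lambda>a b. x a * x b * \<phi> (add_mset a (add_mset b v)))"
      if "size v = N" "set_mset v \<subseteq> V" for v
      using that by (rule base)
    show "\<phi> (add_mset o' v) > 0" if "a \<in> V" "\<phi> (add_mset a v) > 0" for a v
      using that by (rule ex)
  qed (fact fin o x \<phi> u)+
  have "(x o')\<^sup>2 * A d (add_mset o' (add_mset o' u)) * A (Suc (Suc d)) u
      \<le> (x o' * A (Suc d) (add_mset o' u))\<^sup>2"
    using hyp[unfolded hyperbolic_at_one_def, THEN spec, of y] by (simp only: E L T)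
  then have "(x o')\<^sup>2 * (A d (add_mset o' (add_mset o' u)) * A (Suc (Suc d)) u)
      \<le> (x o')\<^sup>2 * (A (Suc d) (add_mset o' u))\<^sup>2"
    by (simp add: power_mult_distrib mult.assoc)
  moreover have "(x o')\<^sup>2 > 0" using x[OF o] by simp
  ultimately show ?thesis unfolding A_def by (simp only: mult_le_cancel_left_pos)
qed

text \<open>Continuity in the point, used to pass from positive to nonnegative weights.\<close>

lemma tendsto_wsum:
  assumes "\<And>a. a \<in> V \<Longrightarrow> ((\<lambda>s. x s a) \<longlongrightarrow> x0 a) F"
  shows "((\<lambda>s. wsum V (x s) \<phi> d u) \<longlongrightarrow> wsum V x0 \<phi> d u) F"
  by (induction d arbitrary: u) (auto intro!: tendsto_sum tendsto_mult assms)

section \<open>Independent sets of a matroid\<close>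

lemma sum_squared_le_card:
  fixes f :: "'a \<Rightarrow> real"
  shows "(\<Sum>i\<in>A. f i)\<^sup>2 \<le> (\<Sum>i\<in>A. (f i)\<^sup>2) * card A"
proof (cases "card A = 0")
  case True
  then show ?thesis by (cases "finite A") auto
next
  case False
  define T where "T = (\<Sum>i\<in>A. f i)"
  have "0 \<le> (\<Sum>i\<in>A. (card A * f i - T)\<^sup>2)" by (intro sum_nonneg) auto
  also have "\<dots> = (\<Sum>i\<in>A. (card A)\<^sup>2 * (f i)\<^sup>2 - 2 * card A * T * f i + T\<^sup>2)"
    by (intro sum.cong refl) (simp add: power2_eq_square algebra_simps)
  also have "\<dots> = (card A)\<^sup>2 * (\<Sum>i\<in>A. (f i)\<^sup>2) - 2 * card A * T * T + card A * T\<^sup>2"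
    by (simp add: sum.distrib sum_subtractf T_def flip: sum_distrib_left)
  also have "\<dots> = card A * ((\<Sum>i\<in>A. (f i)\<^sup>2) * card A - T\<^sup>2)"
    by (simp add: power2_eq_square algebra_simps)
  finally show ?thesis using False by (simp add: T_def zero_le_mult_iff)
qed

text \<open>The double sum collects into the squares of the block sums, and there are at most
  \<open>card N\<close> blocks.\<close>

lemma sum_squared_le_card_blocks:
  fixes z :: "'a \<Rightarrow> real" and cls :: "'a \<Rightarrow> 'b"
  assumes fin: "finite N"
  shows "(\<Sum>i\<in>N. z i)\<^sup>2 \<le> card N * (\<Sum>i\<in>N. \<Sum>j\<in>N. if cls i = cls j then z i * z j else 0)"
proof -
  define S where "S c = (\<Sum>i\<in>{i\<in>N. cls i = c}. z i)" for c
  have "(\<Sum>i\<in>N. \<Sum>j\<in>N. if cls i = cls j then z i * z j else 0) = (\<Sum>i\<in>N. z i * S (cls i))"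
  proof (intro sum.cong refl)
    fix i
    have "(\<Sum>j\<in>N. if cls i = cls j then z i * z j else 0) = (\<Sum>j\<in>{j\<in>N. cls i = cls j}. z i * z j)"
      using fin by (rule sum.inter_filter[symmetric])
    also have "{j\<in>N. cls i = cls j} = {j\<in>N. cls j = cls i}" by auto
    finally show "(\<Sum>j\<in>N. if cls i = cls j then z i * z j else 0) = z i * S (cls i)"
      by (simp only: S_def sum_distrib_left)
  qed
  also have "\<dots> = (\<Sum>c\<in>cls ` N. \<Sum>i\<in>{i\<in>N. cls i = c}. z i * S (cls i))"
    using fin by (rule sum.image_gen)
  also have "\<dots> = (\<Sum>c\<in>cls ` N. (S c)\<^sup>2)"
    by (intro sum.cong refl) (simp add: S_def power2_eq_square sum_distrib_right)
  finally have blocks: "(\<Sum>i\<in>N. \<Sum>j\<in>N. if cls i = cls j then z i * z j else 0)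
      = (\<Sum>c\<in>cls ` N. (S c)\<^sup>2)" .
  have "(\<Sum>i\<in>N. z i)\<^sup>2 = (\<Sum>c\<in>cls ` N. S c)\<^sup>2"
    unfolding S_def sum.image_gen[OF fin, of z cls] ..
  also have "\<dots> \<le> (\<Sum>c\<in>cls ` N. (S c)\<^sup>2) * card (cls ` N)"
    by (rule sum_squared_le_card)
  also have "\<dots> \<le> (\<Sum>c\<in>cls ` N. (S c)\<^sup>2) * card N"
    using fin by (intro mult_left_mono) (auto simp: card_image_le sum_nonneg)
  finally show ?thesis by (simp add: blocks mult.commute)
qed

section \<open>Derivatives of the homogenised polynomial\<close>

context matroid
begin

text \<open>The letter \<open>None\<close> stands for the homogenising variable, and \<open>hcoeff u\<close> is \<open>\<partial>\<^sup>u g\<close> for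
  multisets \<open>u\<close> of size \<open>n\<close>.\<close>

definition letters :: "'a option set" where
  "letters = insert None (Some ` carrier)"

definition elts :: "'a option multiset \<Rightarrow> 'a set" where
  "elts u = {i. Some i \<in># u}"

definition hcoeff :: "'a option multiset \<Rightarrow> real" where
  "hcoeff u = (if indep (elts u) \<and> (\<forall>i. count u (Some i) \<le> 1) then fact (count u None) else 0)"

lemma finite_letters: "finite letters"
  by (simp add: letters_def carrier_finite)

lemma sum_letters: "(\<Sum>a\<in>letters. f a) = f None + (\<Sum>i\<in>carrier. f (Some i))"
  unfolding letters_def using carrier_finite by (subst sum.insert) (auto simp: sum.reindex)

lemma elts_add [simp]:
  "elts (add_mset None u) = elts u" "elts (add_mset (Some i) u) = insert i (elts u)"
  by (auto simp: elts_def)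

lemma hcoeff_nonneg: "hcoeff u \<ge> 0"
  by (simp add: hcoeff_def)

lemma hcoeff_add_None: "hcoeff (add_mset None u) = real (Suc (count u None)) * hcoeff u"
  by (simp add: hcoeff_def)

text \<open>The polynomial is squarefree in the variables of the matroid, so a repeated letter gives
  0; a new one changes nothing as long as independence survives.\<close>

lemma hcoeff_add_Some:
  "hcoeff (add_mset (Some i) u) = (if i \<notin> elts u \<and> indep (insert i (elts u)) then hcoeff u else 0)"
proof (cases "i \<in> elts u")
  case True
  then have "count u (Some i) \<ge> 1" by (simp add: elts_def Suc_le_eq)
  then have "\<not> count (add_mset (Some i) u) (Some i) \<le> 1" by simp
  then have "\<not> (\<forall>j. count (add_mset (Some i) u) (Some j) \<le> 1)" by blast
  then show ?thesis using True by (simp add: hcoeff_def)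
next
  case False
  then have "count u (Some i) = 0" by (simp add: elts_def not_in_iff)
  then have "count (add_mset (Some i) u) (Some j) \<le> 1 \<longleftrightarrow> count u (Some j) \<le> 1" for j
    by (cases "i = j") simp_all
  then show ?thesis using False indep_subset[of "insert i (elts u)" "elts u"]
    by (auto simp: hcoeff_def)
qed

text \<open>Dropping an element preserves independence, so \<open>None\<close> can replace any
  letter.\<close>

lemma hcoeff_exchange: "hcoeff (add_mset a u) > 0 \<Longrightarrow> hcoeff (add_mset None u) > 0"
  by (cases a) (auto simp: hcoeff_add_None hcoeff_add_Some split: if_splits)

text \<open>A nonzero coefficient forces every element letter to occur at most once. This converts
  the order of a derivative into the remaining exponent of the homogenising variable.\<close>

lemma size_eq_elts:
  assumes "hcoeff u \<noteq> 0"
  shows "size u = count u None + card (elts u)"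
proof -
  have I: "indep (elts u)" and le: "\<And>i. count u (Some i) \<le> 1"
    using assms by (auto simp: hcoeff_def split: if_splits)
  have fin: "finite (elts u)" using indep_subset_carrier[OF I] carrier_finite finite_subset by blast
  have "u = replicate_mset (count u None) None + mset_set (Some ` elts u)"
  proof (rule multiset_eqI)
    fix a show "count u a = count (replicate_mset (count u None) None + mset_set (Some ` elts u)) a"
    proof (cases a)
      case None
      then show ?thesis by (auto simp: count_mset_set')
    next
      case (Some i)
      have "count u (Some i) = (if i \<in> elts u then 1 else 0)"
        using le[of i] by (cases "count u (Some i)") (auto simp: elts_def simp flip: count_greater_zero_iff)
      then show ?thesis using fin Some by (auto simp: count_mset_set')
    qed
  qed
  then have "size u = size (replicate_mset (count u None) None + mset_set (Some ` elts u))" by simp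
  then show ?thesis by (simp add: card_image)
qed

text \<open>Parallelism in the contraction by \<open>I\<close> is transitive: if \<open>i\<close>
  and \<open>l\<close> were independent over \<open>I\<close>, augmentation would add one of them to
  \<open>insert j I\<close>, against one of the two assumptions.\<close>

lemma parallel_trans:
  assumes "indep I" "i \<notin> I" "l \<notin> I" "j \<notin> I" "indep (insert j I)"
    and "i = j \<or> \<not> indep (insert i (insert j I))" "j = l \<or> \<not> indep (insert j (insert l I))"
  shows "i = l \<or> \<not> indep (insert i (insert l I))"
proof (rule ccontr)
  assume "\<not> ?thesis"
  then have il: "i \<noteq> l" "indep (insert i (insert l I))" by auto
  have "finite I" using assms(1) indep_subset_carrier carrier_finite finite_subset by blast
  then have "card (insert j I) < card (insert i (insert l I))" using il assms by simp
  then obtain x where "x \<in> insert i (insert l I) - insert j I" "indep (insert x (insert j I))"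
    using augment[OF il(2) assms(5)] by blast
  then show False using assms(6,7) by (auto simp: insert_commute)
qed

text \<open>Up to the factor \<open>hcoeff u\<close> the form is r (r - 1) z0^2 + 2 (r - 1) z0 S +
  S^2 - Q, with Q the sum over parallel pairs. A shift achieving S = - r z0 reduces it to r z0^2 -
  Q, which is nonpositive because S^2 \<le> r Q.\<close>

lemma hcoeff_hyperbolic:
  assumes x: "\<And>a. a \<in> letters \<Longrightarrow> x a > 0" and size: "size u + 2 = card carrier"
  shows "hyperbolic_at_one letters (\<lambda>a b. x a * x b * hcoeff (add_mset a (add_mset b u)))"
proof (cases "hcoeff u = 0")
  case True
  then have "hcoeff (add_mset a (add_mset b u)) = 0" for a b
    by (cases a; cases b) (simp_all add: hcoeff_add_None hcoeff_add_Some)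
  then show ?thesis by (simp add: hyperbolic_at_one_def)
next
  case False
  define I where "I = elts u"
  define k where "k = count u None"
  \<comment> \<open>The non-loops of the contraction by \<open>I\<close>; \<open>R\<close> is
    parallelism among them.\<close>
  define N where "N = {i\<in>carrier. i \<notin> I \<and> indep (insert i I)}"
  define R where "R i j \<longleftrightarrow> i = j \<or> \<not> indep (insert i (insert j I))" for i j
  \<comment> \<open>Since \<open>u\<close> has two letters fewer than the ground set has elements,
    \<open>r\<close> equals \<open>card carrier - card I\<close> and so bounds
    \<open>card N\<close>.\<close>
  define r where "r = real (k + 2)"
  have I: "indep I" using False by (auto simp: hcoeff_def I_def split: if_splits)
  have finN: "finite N" by (simp add: N_def carrier_finite)
  have "k + 2 + card I = card carrier"
    using size size_eq_elts[OF False] by (simp add: I_def k_def)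
  moreover have "card (carrier - I) = card carrier - card I"
    using indep_subset_carrier[OF I] carrier_finite by (meson card_Diff_subset finite_subset)
  moreover have "card N \<le> card (carrier - I)"
    using carrier_finite by (intro card_mono) (auto simp: N_def)
  ultimately have cardN: "real (card N) \<le> r" by (simp add: r_def)
  have r: "r \<ge> 2" by (simp add: r_def)

  \<comment> \<open>Labelling each element by its parallel class turns the relation into a function,
    as the block inequality expects.\<close>
  define cls where "cls i = {j\<in>N. R i j}" for i
  have Rsym: "R i j \<longleftrightarrow> R j i" for i j by (auto simp: R_def insert_commute)
  have Rtrans: "R i j \<Longrightarrow> R j l \<Longrightarrow> R i l" if "i \<in> N" "j \<in> N" "l \<in> N" for i j l
    using parallel_trans[OF I, of i l j] that by (auto simp: N_def R_def)
  have cls: "R i j \<longleftrightarrow> cls i = cls j" if "i \<in> N" "j \<in> N" for i j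
  proof
    assume "R i j"
    then have "R i l \<longleftrightarrow> R j l" if "l \<in> N" for l
      using Rtrans[OF \<open>i \<in> N\<close> \<open>j \<in> N\<close> that] Rtrans[OF \<open>j \<in> N\<close> \<open>i \<in> N\<close> that] Rsym[of i j]
      by blast
    then show "cls i = cls j" by (auto simp: cls_def)
  next
    assume "cls i = cls j"
    moreover have "j \<in> cls j" using \<open>j \<in> N\<close> by (simp add: cls_def R_def)
    ultimately show "R i j" by (auto simp: cls_def)
  qed

  have h00: "hcoeff (add_mset None (add_mset None u)) = r * (r - 1) * hcoeff u"
    by (simp add: hcoeff_add_None r_def k_def algebra_simps)
  have h01: "hcoeff (add_mset None (add_mset (Some i) u)) = (if i \<in> N then (r - 1) * hcoeff u else 0)"
    if "i \<in> carrier" for i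
    using that by (simp add: hcoeff_add_None hcoeff_add_Some r_def k_def N_def I_def)
  have h11: "hcoeff (add_mset (Some i) (add_mset (Some j) u))
      = (if i \<in> N then if j \<in> N then if cls i = cls j then 0 else hcoeff u else 0 else 0)"
    if ij: "i \<in> carrier" "j \<in> carrier" for i j
  proof -
    have "indep (insert i I)" "indep (insert j I)" if "indep (insert i (insert j I))"
      using indep_subset[OF that] by blast+
    then have "hcoeff (add_mset (Some i) (add_mset (Some j) u))
        = (if i \<in> N \<and> j \<in> N \<and> \<not> R i j then hcoeff u else 0)"
      using ij by (auto simp: hcoeff_add_Some N_def R_def simp flip: I_def)
    then show ?thesis using cls by auto
  qed
  have form: "(\<Sum>a\<in>letters. \<Sum>b\<in>letters. hcoeff (add_mset a (add_mset b u)) * z a * z b)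
      = hcoeff u * (r * (r - 1) * (z None)\<^sup>2 + 2 * (r - 1) * z None * (\<Sum>i\<in>N. z (Some i))
        + (\<Sum>i\<in>N. z (Some i))\<^sup>2
        - (\<Sum>i\<in>N. \<Sum>j\<in>N. if cls i = cls j then z (Some i) * z (Some j) else 0))" for z
  proof -
    have restr: "(\<Sum>i\<in>carrier. if i \<in> N then f i else 0) = (\<Sum>i\<in>N. f i)" for f :: "'a \<Rightarrow> real"
      using carrier_finite by (subst sum.inter_restrict[symmetric]) (auto intro!: sum.cong simp: N_def)
    have "(\<Sum>i\<in>carrier. hcoeff (add_mset None (add_mset (Some i) u)) * z None * z (Some i))
        = (\<Sum>i\<in>carrier. if i \<in> N then (r - 1) * hcoeff u * z None * z (Some i) else 0)"
      by (intro sum.cong refl) (simp add: h01)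
    also have "\<dots> = (r - 1) * hcoeff u * z None * (\<Sum>i\<in>N. z (Some i))"
      by (simp add: restr sum_distrib_left)
    finally have s01: "(\<Sum>i\<in>carrier. hcoeff (add_mset None (add_mset (Some i) u)) * z None * z (Some i))
        = (r - 1) * hcoeff u * z None * (\<Sum>i\<in>N. z (Some i))" .
    have s10: "(\<Sum>i\<in>carrier. hcoeff (add_mset (Some i) (add_mset None u)) * z (Some i) * z None)
        = (r - 1) * hcoeff u * z None * (\<Sum>i\<in>N. z (Some i))"
      unfolding s01[symmetric] by (simp add: add_mset_commute mult.commute mult.left_commute)
    have "(\<Sum>i\<in>carrier. \<Sum>j\<in>carrier. hcoeff (add_mset (Some i) (add_mset (Some j) u)) * z (Some i) * z (Some j))
        = (\<Sum>i\<in>carrier. if i \<in> N then \<Sum>j\<in>carrier. if j \<in> N then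
            (if cls i = cls j then 0 else hcoeff u * z (Some i) * z (Some j)) else 0 else 0)"
      by (auto intro!: sum.cong sum.neutral simp: h11)
    also have "\<dots> = (\<Sum>i\<in>N. \<Sum>j\<in>N. if cls i = cls j then 0 else hcoeff u * z (Some i) * z (Some j))"
      by (simp add: restr)
    also have "\<dots> = (\<Sum>i\<in>N. \<Sum>j\<in>N. hcoeff u * (z (Some i) * z (Some j))
        - hcoeff u * (if cls i = cls j then z (Some i) * z (Some j) else 0))"
      by (intro sum.cong refl) simp
    also have "\<dots> = hcoeff u * (\<Sum>i\<in>N. z (Some i))\<^sup>2
        - hcoeff u * (\<Sum>i\<in>N. \<Sum>j\<in>N. if cls i = cls j then z (Some i) * z (Some j) else 0)"
      by (simp only: sum_subtractf sum_distrib_left[symmetric] power2_eq_square sum_product)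
    finally have s11: "(\<Sum>i\<in>carrier. \<Sum>j\<in>carrier. hcoeff (add_mset (Some i) (add_mset (Some j) u)) * z (Some i) * z (Some j))
        = hcoeff u * (\<Sum>i\<in>N. z (Some i))\<^sup>2
        - hcoeff u * (\<Sum>i\<in>N. \<Sum>j\<in>N. if cls i = cls j then z (Some i) * z (Some j) else 0)" .
    show ?thesis
      by (simp only: sum_letters sum.distrib s01 s10 s11 h00) (simp add: algebra_simps power2_eq_square)
  qed

  show ?thesis
  proof (rule hyperbolic_at_oneI)
    fix a b show "x a * x b * hcoeff (add_mset a (add_mset b u)) = x b * x a * hcoeff (add_mset b (add_mset a u))"
      by (simp only: add_mset_commute mult.commute)
  next
    show "(\<Sum>a\<in>letters. \<Sum>b\<in>letters. x a * x b * hcoeff (add_mset a (add_mset b u))) \<ge> 0"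
      using x by (intro sum_nonneg mult_nonneg_nonneg hcoeff_nonneg) (auto simp: less_imp_le)
  next
    fix y :: "'a option \<Rightarrow> real"
    define L where "L v = r * (x None * v None) + (\<Sum>i\<in>N. x (Some i) * v (Some i))"
      for v :: "'a option \<Rightarrow> real"
    have "L (\<lambda>_. 1) > 0" unfolding L_def
      using r x by (intro add_pos_nonneg sum_nonneg) (auto simp: letters_def N_def less_imp_le)
    define t where "t = L y / L (\<lambda>_. 1)"
    define z where "z a = x a * (y a - t)" for a
    define S where "S = (\<Sum>i\<in>N. z (Some i))"
    define Q where "Q = (\<Sum>i\<in>N. \<Sum>j\<in>N. if cls i = cls j then z (Some i) * z (Some j) else 0)"
    have "r * z None + S = L y - t * L (\<lambda>_. 1)"
      by (simp add: z_def S_def L_def algebra_simps sum_subtractf sum_distrib_left)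
    also have "\<dots> = 0" using \<open>L (\<lambda>_. 1) > 0\<close> by (simp add: t_def)
    finally have S: "S = - r * z None" by simp
    have "Q \<ge> 0"
    proof -
      have "(\<Sum>i\<in>N. z (Some i))\<^sup>2 \<le> card N * Q"
        unfolding Q_def by (rule sum_squared_le_card_blocks[OF finN])
      then show ?thesis
        by (cases "card N = 0") (use finN in \<open>auto simp: Q_def zero_le_mult_iff dest!: order_trans[OF zero_le_power2]\<close>)
    qed
    have "S\<^sup>2 \<le> card N * Q"
      unfolding Q_def S_def by (rule sum_squared_le_card_blocks[OF finN])
    also have "\<dots> \<le> r * Q" using cardN \<open>Q \<ge> 0\<close> by (rule mult_right_mono)
    finally have "r * (r * (z None)\<^sup>2) \<le> r * Q" by (simp add: S power2_eq_square mult_ac)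
    then have "r * (z None)\<^sup>2 \<le> Q" using r by simp
    then have "r * (r - 1) * (z None)\<^sup>2 + 2 * (r - 1) * z None * S + S\<^sup>2 - Q \<le> 0"
      by (simp add: S algebra_simps power2_eq_square)
    then have "hcoeff u * (r * (r - 1) * (z None)\<^sup>2 + 2 * (r - 1) * z None * S + S\<^sup>2 - Q) \<le> 0"
      using hcoeff_nonneg by (rule mult_nonneg_nonpos[rotated])
    then have "(\<Sum>a\<in>letters. \<Sum>b\<in>letters. hcoeff (add_mset a (add_mset b u)) * z a * z b) \<le> 0"
      by (simp only: form S_def Q_def)
    then show "\<exists>t. (\<Sum>a\<in>letters. \<Sum>b\<in>letters.
        x a * x b * hcoeff (add_mset a (add_mset b u)) * (y a - t) * (y b - t)) \<le> 0"
      by (intro exI[of _ t]) (simp add: z_def mult_ac)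
  qed
qed

section \<open>Values where the homogenising variable is zero\<close>

definition exts :: "'a set \<Rightarrow> nat \<Rightarrow> 'a set set" where
  "exts I d = {J. I \<inter> J = {} \<and> indep (I \<union> J) \<and> card J = d}"

lemma finite_exts: "finite (exts I d)"
  using carrier_finite indep_subset_carrier
  by (intro finite_subset[of "exts I d" "Pow carrier"]) (auto simp: exts_def)

lemma exts_finite: "J \<in> exts I d \<Longrightarrow> finite J"
  using carrier_finite indep_subset_carrier[of "I \<union> J"] finite_subset[of J carrier]
  by (auto simp: exts_def)

text \<open>Double counting of pairs of an extension of size d + 1 and a chosen element of it:
  removing the element gives the left side, forgetting the choice the right.\<close>

lemma sum_exts_Suc:
  fixes w :: "'a \<Rightarrow> real"
  shows "(\<Sum>i\<in>carrier - I. w i * (\<Sum>J\<in>exts (insert i I) d. \<Prod>j\<in>J. w j))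
    = real (Suc d) * (\<Sum>J\<in>exts I (Suc d). \<Prod>j\<in>J. w j)"
proof -
  have "(\<Sum>i\<in>carrier - I. w i * (\<Sum>J\<in>exts (insert i I) d. \<Prod>j\<in>J. w j))
      = (\<Sum>(i, J)\<in>Sigma (carrier - I) (\<lambda>i. exts (insert i I) d). w i * (\<Prod>j\<in>J. w j))"
    by (subst sum.Sigma[symmetric]) (auto simp: carrier_finite finite_exts sum_distrib_left)
  also have "\<dots> = (\<Sum>(J, i)\<in>Sigma (exts I (Suc d)) (\<lambda>J. J). \<Prod>j\<in>J. w j)"
  proof (rule sum.reindex_bij_witness[where
        i = "\<lambda>(J, i). (i, J - {i})" and j = "\<lambda>(i, J). (insert i J, i)"])
    fix p assume p: "p \<in> Sigma (carrier - I) (\<lambda>i. exts (insert i I) d)"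
    obtain i J where pq: "p = (i, J)" by force
    have J: "J \<in> exts (insert i I) d" "i \<notin> I" using p by (auto simp: pq)
    have iJ: "i \<notin> J" "finite J" using J(1) exts_finite[OF J(1)] by (auto simp: exts_def)
    then show "(case (case p of (i, J) \<Rightarrow> (insert i J, i)) of (J, i) \<Rightarrow> (i, J - {i})) = p"
      by (simp add: pq)
    show "(case p of (i, J) \<Rightarrow> (insert i J, i)) \<in> Sigma (exts I (Suc d)) (\<lambda>J. J)"
      using J iJ by (auto simp: pq exts_def)
    show "(case (case p of (i, J) \<Rightarrow> (insert i J, i)) of (J, i) \<Rightarrow> \<Prod>j\<in>J. w j)
        = (case p of (i, J) \<Rightarrow> w i * (\<Prod>j\<in>J. w j))"
      using iJ by (simp add: pq)
  next
    fix p assume p: "p \<in> Sigma (exts I (Suc d)) (\<lambda>J. J)"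
    obtain J i where pq: "p = (J, i)" by force
    have J: "i \<in> J" "J \<in> exts I (Suc d)" "finite J"
      using p exts_finite by (auto simp: pq)
    then show "(case (case p of (J, i) \<Rightarrow> (i, J - {i})) of (i, J) \<Rightarrow> (insert i J, i)) = p"
      by (auto simp: pq)
    have "insert i I \<union> (J - {i}) = I \<union> J" using J by auto
    then show "(case p of (J, i) \<Rightarrow> (i, J - {i})) \<in> Sigma (carrier - I) (\<lambda>i. exts (insert i I) d)"
      using J indep_subset_carrier[of "I \<union> J"] by (auto simp: pq exts_def)
  qed
  also have "\<dots> = (\<Sum>J\<in>exts I (Suc d). \<Sum>i\<in>J. \<Prod>j\<in>J. w j)"
    by (subst sum.Sigma[symmetric]) (auto simp: finite_exts exts_finite)
  also have "\<dots> = real (Suc d) * (\<Sum>J\<in>exts I (Suc d). \<Prod>j\<in>J. w j)"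
    by (simp add: sum_distrib_left exts_def)
  finally show ?thesis .
qed

text \<open>The \<open>None\<close> summand is killed by its weight 0. The others recombine by
  \<open>sum_exts_Suc\<close>, each step contributing one factor of \<open>fact d\<close>.\<close>

lemma wsum_hcoeff:
  "wsum letters (case_option 0 w) hcoeff d u
    = fact d * hcoeff u * (\<Sum>J\<in>exts (elts u) d. \<Prod>j\<in>J. w j)"
proof (induction d arbitrary: u)
  case 0
  show ?case
  proof (cases "indep (elts u)")
    case True
    then have "exts (elts u) 0 = {{}}"
      using exts_finite by (auto simp: exts_def)
    then show ?thesis by simp
  qed (simp add: hcoeff_def)
next
  case (Suc d)
  have "wsum letters (case_option 0 w) hcoeff (Suc d) u
      = (\<Sum>i\<in>carrier. w i * (fact d * hcoeff (add_mset (Some i) u)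
          * (\<Sum>J\<in>exts (insert i (elts u)) d. \<Prod>j\<in>J. w j)))"
    by (simp add: sum_letters Suc.IH)
  also have "\<dots> = (\<Sum>i\<in>carrier - elts u. fact d * hcoeff u *
      (w i * (\<Sum>J\<in>exts (insert i (elts u)) d. \<Prod>j\<in>J. w j)))"
  proof (rule sum.mono_neutral_cong_right)
    fix i assume i: "i \<in> carrier - elts u"
    \<comment> \<open>If adding \<open>i\<close> destroys independence, the coefficient on the left
      is 0 and the sum on the right is empty.\<close>
    have "exts (insert i (elts u)) d = {}" if "\<not> indep (insert i (elts u))"
      using that indep_subset unfolding exts_def by blast
    then show "w i * (fact d * hcoeff (add_mset (Some i) u) * (\<Sum>J\<in>exts (insert i (elts u)) d. \<Prod>j\<in>J. w j))
        = fact d * hcoeff u * (w i * (\<Sum>J\<in>exts (insert i (elts u)) d. \<Prod>j\<in>J. w j))"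
      using i by (auto simp: hcoeff_add_Some)
  qed (auto simp: carrier_finite hcoeff_add_Some)
  also have "\<dots> = fact d * hcoeff u * (real (Suc d) * (\<Sum>J\<in>exts (elts u) (Suc d). \<Prod>j\<in>J. w j))"
    by (simp only: sum_distrib_left[symmetric] sum_exts_Suc)
  finally show ?case by (simp add: mult_ac)
qed

lemma wsum_hcoeff_None:
  "wsum letters (case_option 0 w) hcoeff d (replicate_mset k None)
    = fact d * fact k * indep_gen_fun indep d w"
proof -
  have "elts (replicate_mset k None) = {}" by (auto simp: elts_def)
  moreover have "hcoeff (replicate_mset k None) = fact k"
    by (simp add: hcoeff_def elts_def indep_empty)
  moreover have "exts {} d = indep_sets_of_size indep d"
    by (simp add: exts_def indep_sets_of_size_def)
  ultimately show ?thesis by (simp add: wsum_hcoeff indep_gen_fun_def)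
qed

text \<open>Take \<open>u\<close> to be n - m - 1 copies of \<open>None\<close>. With two, one and
  no further copies, the degrees m - 1, m and m + 1 produce the three generating functions with
  these factorials.\<close>

theorem indep_gen_fun_ultra_log_concave:
  assumes m: "0 < m" "m < card carrier" and w: "\<And>i. i \<in> carrier \<Longrightarrow> w i \<ge> 0"
  defines "n \<equiv> card carrier"
  shows "(fact (m - 1) * fact (n - (m - 1)) * indep_gen_fun indep (m - 1) w)
      * (fact (m + 1) * fact (n - (m + 1)) * indep_gen_fun indep (m + 1) w)
    \<le> (fact m * fact (n - m) * indep_gen_fun indep m w)\<^sup>2"
proof -
  define k where "k = n - (m + 1)"
  define d where "d = m - 1"
  have md: "m = Suc d" "n - m = Suc k" "n - (m - 1) = Suc (Suc k)" "n - (m + 1) = k"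
    using m by (auto simp: k_def d_def n_def)
  define u :: "'a option multiset" where "u = replicate_mset k None"
  \<comment> \<open>Adding 1/(s+1) to every coordinate, including the homogenising one, gives
    positive points converging to the boundary point.\<close>
  define x where "x s a = case_option 0 w a + inverse (real (Suc s))" for s a
  have xpos: "x s a > 0" if "a \<in> letters" for s a
    using w that by (auto simp: x_def letters_def intro!: add_nonneg_pos)
  have lim: "(\<lambda>s. wsum letters (x s) hcoeff e v) \<longlonglongrightarrow> wsum letters (case_option 0 w) hcoeff e v" for e v
  proof (rule tendsto_wsum)
    fix a show "(\<lambda>s. x s a) \<longlonglongrightarrow> case_option 0 w a"
      unfolding x_def using tendsto_add[OF tendsto_const LIMSEQ_inverse_real_of_nat] by fastforce
  qed
  have "wsum letters (x s) hcoeff d (add_mset None (add_mset None u))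
        * wsum letters (x s) hcoeff (Suc (Suc d)) u
      \<le> (wsum letters (x s) hcoeff (Suc d) (add_mset None u))\<^sup>2" for s
  proof (rule wsum_log_concave[where N = "n - 2"])
    show "hyperbolic_at_one letters (\<lambda>a b. x s a * x s b * hcoeff (add_mset a (add_mset b v)))"
      if "size v = n - 2" for v
      using that m xpos by (intro hcoeff_hyperbolic) (auto simp: n_def)
    show "size u + d = n - 2" using m by (simp add: u_def k_def d_def n_def)
  qed (use finite_letters xpos hcoeff_nonneg hcoeff_exchange in \<open>auto simp: letters_def u_def\<close>)
  then have "wsum letters (case_option 0 w) hcoeff d (add_mset None (add_mset None u))
        * wsum letters (case_option 0 w) hcoeff (Suc (Suc d)) u
      \<le> (wsum letters (case_option 0 w) hcoeff (Suc d) (add_mset None u))\<^sup>2"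
    by (intro LIMSEQ_le[OF tendsto_mult[OF lim lim] tendsto_power[OF lim]]) auto
  then have "wsum letters (case_option 0 w) hcoeff d (replicate_mset (Suc (Suc k)) None)
        * wsum letters (case_option 0 w) hcoeff (Suc (Suc d)) (replicate_mset k None)
      \<le> (wsum letters (case_option 0 w) hcoeff (Suc d) (replicate_mset (Suc k) None))\<^sup>2"
    by (simp only: u_def replicate_mset_Suc)
  then have main: "(fact d * fact (Suc (Suc k)) * indep_gen_fun indep d w)
      * (fact (Suc (Suc d)) * fact k * indep_gen_fun indep (Suc (Suc d)) w)
    \<le> (fact (Suc d) * fact (Suc k) * indep_gen_fun indep (Suc d) w)\<^sup>2"
    by (simp only: wsum_hcoeff_None)
  have "m - 1 = d" "m + 1 = Suc (Suc d)" using md(1) by auto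
  then show ?thesis unfolding md(2-4) using main by (simp only: md(1))
qed

end

text \<open>Each reciprocal binomial coefficient is j! (n - j)! / n!, so the claim is the factorial
  form divided by (n!)^2.\<close>

theorem corollary7:
  fixes n m :: nat
    and indep :: "nat set \<Rightarrow> bool"
    and w :: "nat \<Rightarrow> real"
  assumes "n \<ge> 2"
    and "matroid {1..n} indep"
    and "0 < m" and "m < n"
    and "\<And>i. i \<in> {1..n} \<Longrightarrow> w i \<ge> 0"
  shows "(indep_gen_fun indep m w)\<^sup>2 / (real (n choose m))\<^sup>2
    \<ge> (indep_gen_fun indep (m + 1) w / real (n choose (m + 1)))
      * (indep_gen_fun indep (m - 1) w / real (n choose (m - 1)))"
proof -
  interpret matroid "{1..n}" indep by (rule assms(2))
  have scaled: "indep_gen_fun indep j w / real (n choose j)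
      = fact j * fact (n - j) * indep_gen_fun indep j w / fact n" if "j \<le> n" for j
    using that by (simp add: binomial_fact)
  have "(fact (m - 1) * fact (n - (m - 1)) * indep_gen_fun indep (m - 1) w)
      * (fact (m + 1) * fact (n - (m + 1)) * indep_gen_fun indep (m + 1) w) / (fact n)\<^sup>2
    \<le> (fact m * fact (n - m) * indep_gen_fun indep m w)\<^sup>2 / (fact n)\<^sup>2"
    using indep_gen_fun_ultra_log_concave[of m w] assms by (intro divide_right_mono) auto
  then have "(fact (m + 1) * fact (n - (m + 1)) * indep_gen_fun indep (m + 1) w / fact n)
      * (fact (m - 1) * fact (n - (m - 1)) * indep_gen_fun indep (m - 1) w / fact n)
    \<le> (fact m * fact (n - m) * indep_gen_fun indep m w / fact n)\<^sup>2"
    by (simp only: times_divide_times_eq power_divide power2_eq_square mult.commute)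
  then have "(indep_gen_fun indep (m + 1) w / real (n choose (m + 1)))
      * (indep_gen_fun indep (m - 1) w / real (n choose (m - 1)))
    \<le> (indep_gen_fun indep m w / real (n choose m))\<^sup>2"
    using assms(3,4) by (subst (1 2 3) scaled) auto
  then show ?thesis by (simp only: power_divide)
qed

end
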